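(* The conjugacy relation on the automorphism group of the graph $\infty\cdot K_\infty$ is Borel bireducible with $E_{\mathsf{set}}$.
   Context: $\infty\cdot K_\infty$ is the undirected graph consisting of countably infinitely many disjoint copies of the countably infinite complete graph, with no edges between copies. Its automorphism group is a Polish group and the conjugacy relation identifies $\phi,\psi$ iff $\psi=\delta\phi\delta^{-1}$ for some automorphism $\delta$. $E_{\mathsf{set}}$ is the equivalence relation on $\mathbb{R}^\omega$ given by $\sigma\mathrel{E_{\mathsf{set}}}\tau$ iff $\{\sigma(i):i\in\omega\}=\{\tau(i):i\in\omega\}$. For equivalence relations $E,F$ on standard Borel spaces $X,Y$, $E\leq_B F$ means there is a Borel $f\colon X\to Y$ with $x\mathrel{E}x'\iff f(x)\mathrel{F}f(x')$; bireducible means $E\leq_B F$ and $F\leq_B E$. *)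

theory Defs
  imports "HOL-Analysis.Analysis"
begin

text \<open>A graph is given by its adjacency relation; its vertex set is the whole vertex type.\<close>

definition graph_automorphisms :: "('v \<Rightarrow> 'v \<Rightarrow> bool) \<Rightarrow> ('v \<Rightarrow> 'v) set" where
  "graph_automorphisms adj = {\<phi>. bij \<phi> \<and> (\<forall>x y. adj (\<phi> x) (\<phi> y) \<longleftrightarrow> adj x y)}"

definition conjugacy :: "('v \<Rightarrow> 'v) set \<Rightarrow> (('v \<Rightarrow> 'v) \<times> ('v \<Rightarrow> 'v)) set" where
  "conjugacy G = {(\<phi>, \<psi>). \<phi> \<in> G \<and> \<psi> \<in> G \<and> (\<exists>\<delta>\<in>G. \<psi> = \<delta> \<circ> \<phi> \<circ> inv \<delta>)}"

text \<open>The graph $\infty\cdot K_\infty$: the vertex \<open>(i, m)\<close> is the \<open>m\<close>-th vertex of the \<open>i\<close>-th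
  copy of the complete graph on \<open>nat\<close>.\<close>

definition inf_K_inf :: "nat \<times> nat \<Rightarrow> nat \<times> nat \<Rightarrow> bool" where
  "inf_K_inf u v \<longleftrightarrow> fst u = fst v \<and> snd u \<noteq> snd v"

text \<open>The topology on functions is the product topology and \<open>nat \<times> nat\<close> is discrete, so this is
  the Borel structure of the topology of pointwise convergence on the automorphism group.\<close>

definition aut_inf_K_inf :: "(nat \<times> nat \<Rightarrow> nat \<times> nat) measure" where
  "aut_inf_K_inf = restrict_space borel (graph_automorphisms inf_K_inf)"

definition E_set :: "((nat \<Rightarrow> real) \<times> (nat \<Rightarrow> real)) set" where
  "E_set = {(\<sigma>, \<tau>). range \<sigma> = range \<tau>}"

text \<open>Only the measurable structure of the \<open>measure\<close> arguments is used.\<close>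

definition borel_reducible ::
    "'a measure \<Rightarrow> ('a \<times> 'a) set \<Rightarrow> 'b measure \<Rightarrow> ('b \<times> 'b) set \<Rightarrow> bool" where
  "borel_reducible X E Y F \<longleftrightarrow>
     (\<exists>f \<in> X \<rightarrow>\<^sub>M Y. \<forall>x\<in>space X. \<forall>x'\<in>space X. (x, x') \<in> E \<longleftrightarrow> (f x, f x') \<in> F)"

definition borel_bireducible ::
    "'a measure \<Rightarrow> ('a \<times> 'a) set \<Rightarrow> 'b measure \<Rightarrow> ('b \<times> 'b) set \<Rightarrow> bool" where
  "borel_bireducible X E Y F \<longleftrightarrow> borel_reducible X E Y F \<and> borel_reducible Y F X E"

lemma space_aut_inf_K_inf: "space aut_inf_K_inf = graph_automorphisms inf_K_inf"
  by (simp add: aut_inf_K_inf_def space_restrict_space)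

lemma open_nat_prod: "open (A :: (nat \<times> nat) set)"
proof (rule open_prod_intro)
  fix x assume "x \<in> A"
  then show "\<exists>S T. open S \<and> open T \<and> x \<in> S \<times> T \<and> S \<times> T \<subseteq> A"
    by (intro exI[of _ "{fst x}"] exI[of _ "{snd x}"]) (auto simp: open_discrete)
qed

text \<open>The automorphism group is a Borel subset of the Polish space of all functions, so
  \<open>aut_inf_K_inf\<close> is a standard Borel space.\<close>

lemma graph_automorphisms_borel: "graph_automorphisms inf_K_inf \<in> sets borel"
proof -
  have ev: "{\<phi> :: nat \<times> nat \<Rightarrow> nat \<times> nat. \<phi> x \<in> A} \<in> sets borel" for x A
  proof -
    have "open ((\<lambda>\<phi> :: nat \<times> nat \<Rightarrow> nat \<times> nat. \<phi> x) -` A)"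
      by (intro open_vimage open_nat_prod continuous_on_product_coordinates)
    then show ?thesis by (simp add: vimage_def)
  qed
  have ev2: "{\<phi> :: nat \<times> nat \<Rightarrow> nat \<times> nat. P (\<phi> x) (\<phi> y)} \<in> sets borel" for x y P
  proof -
    have "{\<phi> :: nat \<times> nat \<Rightarrow> nat \<times> nat. P (\<phi> x) (\<phi> y)}
        = (\<Union>a. {\<phi>. \<phi> x \<in> {a}} \<inter> {\<phi>. \<phi> y \<in> {b. P a b}})" by auto
    also have "\<dots> \<in> sets borel" by (intro sets.countable_UN'' sets.Int ev) auto
    finally show ?thesis .
  qed
  have "graph_automorphisms inf_K_inf
      = (\<Inter>x y. {\<phi>. \<phi> x = \<phi> y \<longrightarrow> x = y}) \<inter> (\<Inter>y. \<Union>x. {\<phi>. \<phi> x \<in> {y}})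
        \<inter> (\<Inter>x y. {\<phi>. inf_K_inf (\<phi> x) (\<phi> y) \<longleftrightarrow> inf_K_inf x y})"
  proof -
    have "surj \<phi> \<longleftrightarrow> (\<forall>y. \<exists>x. \<phi> x = y)" for \<phi> :: "nat \<times> nat \<Rightarrow> nat \<times> nat"
      unfolding surj_def by metis
    then show ?thesis
      by (intro set_eqI)
        (simp only: graph_automorphisms_def bij_def inj_def mem_Collect_eq Int_iff INT_iff UN_iff
          UNIV_I singleton_iff ball_UNIV bex_UNIV)
  qed
  moreover have "\<dots> \<in> sets borel"
    by (intro sets.Int sets.countable_INT'' sets.countable_UN'' ev
        ev2[where P = "\<lambda>a b. (a = b) \<longrightarrow> _"] ev2[where P = "\<lambda>a b. inf_K_inf a b \<longleftrightarrow> _"]) simp_all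
  ultimately show ?thesis by simp
qed

lemma graph_automorphisms_id: "id \<in> graph_automorphisms adj"
  by (simp add: graph_automorphisms_def)

lemma graph_automorphisms_comp:
  "\<phi> \<in> graph_automorphisms adj \<Longrightarrow> \<psi> \<in> graph_automorphisms adj
    \<Longrightarrow> \<phi> \<circ> \<psi> \<in> graph_automorphisms adj"
  by (simp add: graph_automorphisms_def bij_comp)

lemma graph_automorphisms_inv:
  assumes "\<phi> \<in> graph_automorphisms adj"
  shows "inv \<phi> \<in> graph_automorphisms adj"
proof -
  have b: "bij \<phi>" and a: "\<And>x y. adj (\<phi> x) (\<phi> y) \<longleftrightarrow> adj x y"
    using assms by (auto simp: graph_automorphisms_def)
  have "adj (inv \<phi> x) (inv \<phi> y) \<longleftrightarrow> adj x y" for x y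
    using a[of "inv \<phi> x" "inv \<phi> y"] b by (simp add: bij_is_surj surj_f_inv_f)
  then show ?thesis using b by (simp add: graph_automorphisms_def bij_imp_bij_inv)
qed

lemma equiv_conjugacy:
  "equiv (graph_automorphisms adj) (conjugacy (graph_automorphisms adj))" (is "equiv ?G ?E")
proof (rule equivI)
  have bij: "bij \<delta>" if "\<delta> \<in> ?G" for \<delta> using that by (simp add: graph_automorphisms_def)
  show "?E \<subseteq> ?G \<times> ?G" by (auto simp: conjugacy_def)
  show "refl_on ?G ?E"
    by (auto simp: refl_on_def conjugacy_def intro!: bexI[OF _ graph_automorphisms_id])
  show "sym ?E"
  proof (rule symI)
    fix \<phi> \<psi> assume "(\<phi>, \<psi>) \<in> ?E"
    then obtain \<delta> where d: "\<delta> \<in> ?G" "\<phi> \<in> ?G" "\<psi> \<in> ?G" "\<psi> = \<delta> \<circ> \<phi> \<circ> inv \<delta>"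
      by (auto simp: conjugacy_def)
    have "\<phi> = inv \<delta> \<circ> \<psi> \<circ> inv (inv \<delta>)"
      using bij[OF d(1)] by (simp add: d(4) fun_eq_iff inv_inv_eq bij_is_inj)
    then show "(\<psi>, \<phi>) \<in> ?E"
      using d graph_automorphisms_inv[OF d(1)] by (auto simp: conjugacy_def)
  qed
  show "trans ?E"
  proof (rule transI)
    fix \<phi> \<psi> \<theta> assume "(\<phi>, \<psi>) \<in> ?E" "(\<psi>, \<theta>) \<in> ?E"
    then obtain \<delta> \<epsilon> where d: "\<delta> \<in> ?G" "\<epsilon> \<in> ?G" "\<phi> \<in> ?G" "\<theta> \<in> ?G"
        "\<psi> = \<delta> \<circ> \<phi> \<circ> inv \<delta>" "\<theta> = \<epsilon> \<circ> \<psi> \<circ> inv \<epsilon>"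
      by (auto simp: conjugacy_def)
    have "\<theta> = (\<epsilon> \<circ> \<delta>) \<circ> \<phi> \<circ> inv (\<epsilon> \<circ> \<delta>)"
      using bij[OF d(1)] bij[OF d(2)] d(5,6) by (simp add: o_inv_distrib o_assoc)
    then show "(\<phi>, \<theta>) \<in> ?E"
      using d graph_automorphisms_comp[OF d(2,1)] by (auto simp: conjugacy_def)
  qed
qed

lemma equiv_E_set: "equiv UNIV E_set"
  by (auto simp: E_set_def intro!: equivI refl_onI symI transI)

end

theory Submission
  imports Defs
begin

text \<open>
  An automorphism \<open>\<phi>\<close> permutes the copies of the complete graph. To a copy \<open>i\<close> attach the length of
  its orbit under this permutation and the multiset of the \<open>\<phi>\<close>-periods of the \<open>\<phi>\<close>-orbits that meet
  \<open>i\<close>. This label depends only on the orbit of \<open>i\<close>, and \<open>\<phi>\<close> is determined up to conjugacy by the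
  multiset of the labels of the orbits of copies: a bijection of orbit representatives, of
  copies and then of vertices, that respects all labels extends uniquely to an equivariant bijection
  of the vertices, which preserves copies. A countable multiset becomes a set when its elements are paired with their occurrence numbers, and
  subsets of a countable set are coded by reals.

  Conversely, a sequence of reals is sent to an automorphism that fixes every copy and acts on
  infinitely many copies, for each entry \<open>r\<close>, by a permutation which has a cycle of length \<open>k + 2\<close> if
  and only if the \<open>k\<close>-th rational is below \<open>r\<close>.
\<close>

subsection \<open>Integer iterates and periods\<close>

text \<open>For a bijection this is the action of the integers generated by \<open>f\<close>.
  Two-sided iterates make orbits and stabilizers those of a group action.\<close>

definition zpow :: "('a \<Rightarrow> 'a) \<Rightarrow> int \<Rightarrow> 'a \<Rightarrow> 'a" where
  "zpow f k = (if 0 \<le> k then f ^^ nat k else inv f ^^ nat (- k))"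

definition same_orbit :: "('a \<Rightarrow> 'a) \<Rightarrow> 'a \<Rightarrow> 'a \<Rightarrow> bool" where
  "same_orbit f x y \<longleftrightarrow> (\<exists>k. zpow f k x = y)"

text \<open>The value is \<open>0\<close> on infinite orbits, as \<open>0 dvd k\<close> means \<open>k = 0\<close>.\<close>

definition period :: "('a \<Rightarrow> 'a) \<Rightarrow> 'a \<Rightarrow> nat" where
  "period f x = (LEAST p. \<forall>k. zpow f k x = x \<longleftrightarrow> int p dvd k)"

lemma zpow_0 [simp]: "zpow f 0 x = x"
  by (simp add: zpow_def)

lemma zpow_succ:
  assumes "bij f"
  shows "zpow f (k + 1) x = f (zpow f k x)"
proof -
  have f_inv: "f (inv f y) = y" for y
    using assms by (simp add: bij_is_surj surj_f_inv_f)
  consider "k \<ge> 0" | "k = - 1" | "k < - 1" by linarith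
  then show ?thesis
  proof cases
    case 1
    then have "nat (k + 1) = Suc (nat k)" by simp
    then show ?thesis using 1 by (simp add: zpow_def)
  next
    case 2
    then show ?thesis by (simp add: zpow_def f_inv)
  next
    case 3
    then have "nat (- k) = Suc (nat (- (k + 1)))" by simp
    then show ?thesis using 3 by (simp add: zpow_def f_inv)
  qed
qed

lemma zpow_1: "bij f \<Longrightarrow> zpow f 1 x = f x"
  using zpow_succ[of f 0 x] by simp

lemma zpow_semiconj:
  assumes "bij f" "bij g" and "d \<circ> f = g \<circ> d"
  shows "d (zpow f k x) = zpow g k (d x)"
proof -
  have d: "d (f x) = g (d x)" for x using assms(3) by (simp add: fun_eq_iff)
  show ?thesis
  proof (induction k rule: int_induct[where k = 0])
    case base
    show ?case by simp
  next
    case (step1 i)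
    then show ?case by (simp add: zpow_succ assms d)
  next
    case (step2 i)
    \<comment> \<open>The downward step is checked after one application of \<open>g\<close>, which
      leads back to exponent \<open>i\<close>. Injectivity of \<open>g\<close> then cancels
      it.\<close>
    have "g (d (zpow f (i - 1) x)) = g (zpow g (i - 1) (d x))"
      using step2 zpow_succ[OF assms(1), of "i - 1" x] zpow_succ[OF assms(2), of "i - 1" "d x"]
      by (simp flip: d)
    then show ?case using assms(2) by (simp add: bij_is_inj inj_eq)
  qed
qed

lemma zpow_add:
  assumes "bij f"
  shows "zpow f (j + k) x = zpow f j (zpow f k x)"
proof (induction j rule: int_induct[where k = 0])
  case base
  show ?case by simp
next
  case (step1 i)
  have "zpow f (i + 1 + k) x = f (zpow f (i + k) x)"
    using zpow_succ[OF assms, of "i + k" x] by (simp add: algebra_simps)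
  then show ?case using step1 by (simp add: zpow_succ[OF assms])
next
  case (step2 i)
  have "f (zpow f (i - 1 + k) x) = f (zpow f (i - 1) (zpow f k x))"
    using step2 zpow_succ[OF assms, of "i - 1 + k" x] zpow_succ[OF assms, of "i - 1" "zpow f k x"]
    by simp
  then show ?case using assms by (simp add: bij_is_inj inj_eq)
qed

lemma zpow_minus_cancel:
  assumes "bij f"
  shows "zpow f (- k) (zpow f k x) = x" "zpow f k (zpow f (- k) x) = x"
  by (simp_all flip: zpow_add[OF assms])

lemma zpow_eq_iff:
  assumes "bij f"
  shows "zpow f j x = zpow f k x \<longleftrightarrow> zpow f (j - k) x = x"
proof -
  have "zpow f j x = zpow f k (zpow f (j - k) x)"
    using zpow_add[OF assms, of k "j - k" x] by simp
  then show ?thesis by (metis assms zpow_minus_cancel(1))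
qed

lemma bij_zpow: "bij f \<Longrightarrow> bij (zpow f k)"
  by (rule o_bij[of "zpow f (- k)"]) (simp_all add: fun_eq_iff zpow_minus_cancel)

lemma equivp_same_orbit:
  assumes "bij f"
  shows "equivp (same_orbit f)"
proof (rule equivpI)
  show "reflp (same_orbit f)"
    unfolding reflp_def same_orbit_def by (metis zpow_0)
  show "symp (same_orbit f)"
    unfolding symp_def same_orbit_def by (metis assms zpow_minus_cancel(1))
  show "transp (same_orbit f)"
    unfolding transp_def same_orbit_def by (metis assms zpow_add)
qed

text \<open>The stabilizer \<open>H\<close> of \<open>x\<close> is a subgroup of the integers, hence
  generated by one natural number. So the \<open>LEAST\<close> in \<open>period\<close> ranges over
  a nonempty set.\<close>

lemma zpow_eq_self_iff:
  assumes f: "bij f"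
  shows "zpow f k x = x \<longleftrightarrow> int (period f x) dvd k"
proof -
  define H where "H = {k. zpow f k x = x}"
  have add: "a + b \<in> H" if "a \<in> H" "b \<in> H" for a b
    using that by (simp add: H_def zpow_add[OF f])
  have neg: "- a \<in> H" if "a \<in> H" for a
    using that zpow_minus_cancel(1)[OF f, of a x] by (simp add: H_def)
  have mult: "a * b \<in> H" if "b \<in> H" for a b
  proof (induction a rule: int_induct[where k = 0])
    case base
    show ?case by (simp add: H_def)
  next
    case (step1 i)
    from add[OF step1(2) that] show ?case by (simp add: algebra_simps)
  next
    case (step2 i)
    from add[OF step2(2) neg[OF that]] show ?case by (simp add: algebra_simps)
  qed
  have "\<exists>p. \<forall>k. k \<in> H \<longleftrightarrow> int p dvd k"
  proof (cases "\<exists>p::nat. p > 0 \<and> int p \<in> H")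
    case True
    define p where "p = (LEAST p::nat. p > 0 \<and> int p \<in> H)"
    have p: "p > 0" "int p \<in> H"
      using LeastI_ex[OF True] by (simp_all add: p_def)
    have "int p dvd k" if "k \<in> H" for k
    proof -
      \<comment> \<open>This element is the remainder \<open>k mod int p\<close>. It lies in
        \<open>H\<close> below the least positive element, so it is 0.\<close>
      have "k + (- (k div int p)) * int p \<in> H" by (rule add[OF that mult[OF p(2)]])
      then have "int (nat (k mod int p)) \<in> H"
        using p(1) by (simp add: minus_div_mult_eq_mod)
      moreover have "nat (k mod int p) < p" using p(1) by (simp add: nat_less_iff)
      ultimately have "\<not> nat (k mod int p) > 0"
        using not_less_Least[of "nat (k mod int p)" "\<lambda>p. p > 0 \<and> int p \<in> H"]
        unfolding p_def by simp
      then have "k mod int p = 0" using p(1) by (simp add: order_antisym)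
      then show ?thesis by (simp add: dvd_eq_mod_eq_0)
    qed
    moreover have "k \<in> H" if "int p dvd k" for k
      using that mult[OF p(2)] by (auto simp: mult.commute elim!: dvdE)
    ultimately show ?thesis by blast
  next
    case False
    have "k = 0" if "k \<in> H" for k
    proof (rule ccontr)
      assume "k \<noteq> 0"
      moreover have "int (nat \<bar>k\<bar>) \<in> H" using that neg[OF that] by (cases "k \<ge> 0") auto
      ultimately show False using False by (metis zero_less_abs_iff zero_less_nat_eq)
    qed
    moreover have "0 \<in> H" by (simp add: H_def)
    ultimately show ?thesis by (intro exI[of _ 0]) auto
  qed
  then have "\<exists>p. \<forall>k. zpow f k x = x \<longleftrightarrow> int p dvd k" by (simp add: H_def)
  from LeastI_ex[OF this] show ?thesis unfolding period_def by (rule spec)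
qed

lemma zpow_eq_iff_period:
  assumes "bij f"
  shows "zpow f j x = zpow f k x \<longleftrightarrow> int (period f x) dvd j - k"
  by (rule trans[OF zpow_eq_iff[OF assms] zpow_eq_self_iff[OF assms]])

lemma semiconj_period:
  assumes "bij f" "bij g" "inj d" "d \<circ> f = g \<circ> d"
  shows "period g (d x) = period f x"
proof -
  have "zpow g k (d x) = d x \<longleftrightarrow> zpow f k x = x" for k
    using zpow_semiconj[OF assms(1,2,4), of k x] inj_eq[OF assms(3)] by metis
  then show ?thesis by (simp add: period_def)
qed

lemma semiconj_same_orbit:
  assumes "bij f" "bij g" "inj d" "d \<circ> f = g \<circ> d"
  shows "same_orbit g (d x) (d y) \<longleftrightarrow> same_orbit f x y"
proof -
  have "zpow g k (d x) = d y \<longleftrightarrow> zpow f k x = y" for k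
    using zpow_semiconj[OF assms(1,2,4), of k x] inj_eq[OF assms(3)] by metis
  then show ?thesis by (simp add: same_orbit_def)
qed

lemma zpow_commute: "bij f \<Longrightarrow> zpow f k \<circ> f = f \<circ> zpow f k"
  using zpow_add[of f k 1] zpow_succ[of f k] by (simp add: fun_eq_iff zpow_1)

lemma same_orbit_period:
  assumes "bij f" "same_orbit f x y"
  shows "period f x = period f y"
proof -
  obtain k where "y = zpow f k x" using assms(2) by (auto simp: same_orbit_def)
  then show ?thesis
    using semiconj_period[OF assms(1,1) bij_is_inj[OF bij_zpow[OF assms(1)]]
        zpow_commute[OF assms(1)], of k x] by simp
qed

section \<open>Equivariant extension from orbit representatives\<close>

definition transversal :: "('a \<Rightarrow> 'a) \<Rightarrow> 'a set \<Rightarrow> bool" where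
  "transversal f Y \<longleftrightarrow> (\<forall>x. \<exists>!y. y \<in> Y \<and> same_orbit f y x)"

lemma transversalE:
  assumes "transversal f Y"
  obtains y k where "y \<in> Y" "x = zpow f k y"
  proof -
  obtain y where "y \<in> Y" "same_orbit f y x"
    using assms unfolding transversal_def by blast
  then show ?thesis using that by (auto simp: same_orbit_def)
qed

lemma transversal_eqD:
  assumes "transversal f Y" "y \<in> Y" "y' \<in> Y" "zpow f k y = zpow f k' y'"
  shows "y = y'"
proof -
  have "same_orbit f y (zpow f k y)" "same_orbit f y' (zpow f k y)"
    using assms(4) by (auto simp: same_orbit_def)
  then show ?thesis using assms(1-3) unfolding transversal_def by blast
qed

text \<open>The prescription is consistent: a point determines its representative, and its exponent
  modulo the period. As \<open>G\<close> preserves periods, all admissible exponents give the same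
  value.\<close>

lemma extend_equivariantly:
  assumes f: "bij f" and g: "bij g" and Y: "transversal f Y" and G: "G ` Y \<subseteq> Y'"
    and per: "\<And>y. y \<in> Y \<Longrightarrow> period g (G y) = period f y"
  obtains d where "\<And>y k. y \<in> Y \<Longrightarrow> d (zpow f k y) = zpow g k (G y)"
proof
  \<comment> \<open>An arbitrary presentation of \<open>x\<close> as an iterate of a representative
    is chosen. The rest of the proof shows that the choice does not matter.\<close>
  define d where "d x = (case SOME (y, k). y \<in> Y \<and> x = zpow f k y of (y, k) \<Rightarrow> zpow g k (G y))"
    for x
  fix y k assume y: "y \<in> Y"
  let ?P = "\<lambda>(y', k'). y' \<in> Y \<and> zpow f k y = zpow f k' y'"
  obtain y' k' where eq: "(SOME z. ?P z) = (y', k')" by fastforce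
  have "?P (SOME z. ?P z)" by (rule someI[of ?P "(y, k)"]) (use y in simp)
  then have *: "y' \<in> Y" "zpow f k y = zpow f k' y'" by (simp_all add: eq)
  then have "y' = y" using transversal_eqD[OF Y] y by metis
  with * have "zpow g k (G y) = zpow g k' (G y)"
    by (simp add: zpow_eq_iff_period f g per)
  then show "d (zpow f k y) = zpow g k (G y)"
    using eq \<open>y' = y\<close> by (simp add: d_def)
qed

text \<open>Both \<open>G\<close> and its inverse extend, and the two extensions are mutually
  inverse on every iterate of a representative.\<close>

lemma extend_equivariantly_bij:
  assumes f: "bij f" and g: "bij g" and Y: "transversal f Y" and Y': "transversal g Y'"
    and G: "bij_betw G Y Y'"
    and per: "\<And>y. y \<in> Y \<Longrightarrow> period g (G y) = period f y"
  obtains d where "bij d" "\<And>y k. y \<in> Y \<Longrightarrow> d (zpow f k y) = zpow g k (G y)"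
proof -
  let ?H = "inv_into Y G"
  have GY: "G y \<in> Y'" "?H (G y) = y" if "y \<in> Y" for y
    using that G bij_betw_apply bij_betw_inv_into_left by metis+
  have HY: "?H y \<in> Y" "G (?H y) = y" if "y \<in> Y'" for y
    using that G bij_betw_apply bij_betw_inv_into bij_betw_inv_into_right by metis+
  obtain d where d: "\<And>y k. y \<in> Y \<Longrightarrow> d (zpow f k y) = zpow g k (G y)"
    using extend_equivariantly[OF f g Y _ per, of Y'] GY by blast
  have "period f (?H y) = period g y" if "y \<in> Y'" for y
    using per[OF HY(1)[OF that]] HY(2)[OF that] by simp
  then obtain e where e: "\<And>y k. y \<in> Y' \<Longrightarrow> e (zpow g k y) = zpow f k (?H y)"
    using extend_equivariantly[OF g f Y', of ?H Y] HY by blast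
  have "e (d x) = x" for x
    by (rule transversalE[OF Y, of x]) (simp add: d e GY)
  moreover have "d (e x) = x" for x
    by (rule transversalE[OF Y', of x]) (simp add: d e HY)
  ultimately have "bij d" by (intro o_bij[of e d]) (simp_all add: fun_eq_iff)
  with d that show ?thesis by blast
qed

lemma equivp_pullback: "equivp R \<Longrightarrow> equivp (\<lambda>x y. R (f x) (f y))"
  unfolding equivp_def fun_eq_iff by blast

subsection \<open>Labelled classes counted with multiplicity\<close>

text \<open>Least elements serve as canonical representatives of the classes of an equivalence
  relation. This avoids choice and later keeps membership measurable.\<close>

definition class_minima :: "(nat \<Rightarrow> nat \<Rightarrow> bool) \<Rightarrow> nat set" where
  "class_minima R = {x. \<forall>y<x. \<not> R y x}"

definition class_rank :: "(nat \<Rightarrow> nat \<Rightarrow> bool) \<Rightarrow> (nat \<Rightarrow> 'l) \<Rightarrow> nat \<Rightarrow> nat" where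
  "class_rank R u x = card {y. y \<in> class_minima R \<and> y < x \<and> u y = u x}"

text \<open>A label carried by exactly \<open>n\<close> classes occurs with the ranks \<open>0, \<dots>, n - 1\<close>, so this set
  encodes the multiset of the labels of the classes.\<close>

definition ranked_labels :: "(nat \<Rightarrow> nat \<Rightarrow> bool) \<Rightarrow> (nat \<Rightarrow> 'l) \<Rightarrow> ('l \<times> nat) set" where
  "ranked_labels R u = (\<lambda>x. (u x, class_rank R u x)) ` class_minima R"

lemma zero_in_class_minima [simp]: "0 \<in> class_minima R"
  by (simp add: class_minima_def)

lemma class_minima_nonempty [simp]: "class_minima R \<noteq> {}"
  using zero_in_class_minima by blast

lemma class_minima_ex:
  assumes "equivp R"
  obtains y where "y \<in> class_minima R" "R y x"
proof
  let ?y = "LEAST y. R y x"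
  show y: "R ?y x" by (rule LeastI[of "\<lambda>y. R y x" x]) (rule equivp_reflp[OF assms])
  show "?y \<in> class_minima R"
    unfolding class_minima_def using not_less_Least[of _ "\<lambda>y. R y x"] y equivp_transp[OF assms]
    by blast
qed

lemma class_minima_unique:
  assumes "equivp R" "x \<in> class_minima R" "y \<in> class_minima R" "R x y"
  shows "x = y"
proof -
  have "\<not> x < y" "\<not> y < x"
    using assms equivp_symp[OF assms(1,4)] by (auto simp: class_minima_def)
  then show ?thesis by simp
qed

text \<open>The least element of \<open>X\<close> with at least \<open>k\<close> elements of
  \<open>X\<close> below it has exactly \<open>k\<close> of them.\<close>

lemma ex_card_below:
  fixes X :: "nat set"
  assumes F: "F \<subseteq> X" "finite F" "card F = Suc k"
  shows "\<exists>x\<in>X. card {y\<in>X. y < x} = k"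
proof -
  let ?P = "\<lambda>x. x \<in> X \<and> k \<le> card {y\<in>X. y < x}"
  have "F \<noteq> {}" using F by auto
  then have "Max F \<in> X" using F Max_in by blast
  have "F - {Max F} \<subseteq> {y\<in>X. y < Max F}" using F by (auto simp: le_neq_implies_less)
  then have "card (F - {Max F}) \<le> card {y\<in>X. y < Max F}" by (intro card_mono) auto
  then have "?P (Max F)" using F \<open>Max F \<in> X\<close> Max_in[OF F(2) \<open>F \<noteq> {}\<close>] by simp
  then have x: "?P (Least ?P)" by (rule LeastI)
  define x where "x = Least ?P"
  have "card {y\<in>X. y < x} \<le> k"
  proof (rule ccontr)
    let ?B = "{y\<in>X. y < x}"
    \<comment> \<open>With more than \<open>k\<close> elements below \<open>x\<close>, the largest
      of these would still have at least \<open>k\<close> below it, against minimality of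
      \<open>x\<close>.\<close>
    assume *: "\<not> card ?B \<le> k"
    then have "?B \<noteq> {}" by (metis (no_types, lifting) card.empty le0)
    moreover have "finite ?B" by simp
    ultimately have z: "Max ?B \<in> ?B" using Max_in by blast
    have "?B = insert (Max ?B) {y\<in>X. y < Max ?B}"
      using z \<open>finite ?B\<close> Max_ge[OF \<open>finite ?B\<close>] by (auto simp: le_neq_implies_less)
    then have "card ?B = card (insert (Max ?B) {y\<in>X. y < Max ?B})" by (rule arg_cong)
    also have "\<dots> = Suc (card {y\<in>X. y < Max ?B})" by (rule card_insert_disjoint) auto
    finally have "k \<le> card {y\<in>X. y < Max ?B}" using * by linarith
    with z have "?P (Max ?B)" by blast
    then have "x \<le> Max ?B" unfolding x_def by (rule Least_le)
    with z show False by simp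
  qed
  with x show ?thesis unfolding x_def by (meson order_antisym)
qed

text \<open>Rank \<open>k\<close> occurs for \<open>l\<close> exactly if at least
  \<open>k + 1\<close> classes carry \<open>l\<close>. This form does not mention the order of the
  indices, so it can be transported along maps that do not respect that order.\<close>

lemma mem_ranked_labels_iff:
  assumes R: "equivp R" and u: "\<forall>x y. R x y \<longrightarrow> u x = u y"
  shows "(l, k) \<in> ranked_labels R u \<longleftrightarrow>
    (\<exists>F. finite F \<and> card F = Suc k \<and> (\<forall>x\<in>F. u x = l) \<and> (\<forall>x\<in>F. \<forall>y\<in>F. R x y \<longrightarrow> x = y))"
proof
  assume "(l, k) \<in> ranked_labels R u"
  then obtain x where x: "x \<in> class_minima R" "l = u x" "k = class_rank R u x"
    by (auto simp: ranked_labels_def)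
  let ?B = "{y. y \<in> class_minima R \<and> y < x \<and> u y = u x}"
  have "finite (insert x ?B)" "card (insert x ?B) = Suc k"
    using x by (simp_all add: class_rank_def)
  moreover have "\<forall>y\<in>insert x ?B. u y = l" using x by auto
  moreover have "\<forall>y\<in>insert x ?B. \<forall>z\<in>insert x ?B. R y z \<longrightarrow> y = z"
    using class_minima_unique[OF R] x(1) by blast
  ultimately show "\<exists>F. finite F \<and> card F = Suc k \<and> (\<forall>x\<in>F. u x = l) \<and>
      (\<forall>x\<in>F. \<forall>y\<in>F. R x y \<longrightarrow> x = y)" by blast
next
  assume "\<exists>F. finite F \<and> card F = Suc k \<and> (\<forall>x\<in>F. u x = l) \<and> (\<forall>x\<in>F. \<forall>y\<in>F. R x y \<longrightarrow> x = y)"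
  then obtain F where F: "finite F" "card F = Suc k" "\<forall>x\<in>F. u x = l"
    "\<forall>x\<in>F. \<forall>y\<in>F. R x y \<longrightarrow> x = y" by (elim exE conjE) (rule that)
  \<comment> \<open>Replacing each point by the minimum of its class is injective on
    \<open>F\<close>, whose points are pairwise inequivalent.\<close>
  obtain r where r: "\<And>x. r x \<in> class_minima R" "\<And>x. R (r x) x"
    by (rule that[of "\<lambda>x. SOME y. y \<in> class_minima R \<and> R y x"]; rule someI2_ex)
      (auto intro: class_minima_ex[OF R])
  have "inj_on r F"
  proof (rule inj_onI)
    fix x y assume *: "x \<in> F" "y \<in> F" "r x = r y"
    then have "R (r x) x" "R (r x) y" using r(2)[of x] r(2)[of y] by simp_all
    then have "R x y" using equivp_symp[OF R] equivp_transp[OF R] by blast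
    with * F(4) show "x = y" by blast
  qed
  then have "card (r ` F) = Suc k" using F by (simp add: card_image)
  moreover have "r ` F \<subseteq> {y \<in> class_minima R. u y = l}" using r u F(3) by fastforce
  ultimately obtain x where x: "x \<in> class_minima R" "u x = l"
      "card {y \<in> {y \<in> class_minima R. u y = l}. y < x} = k"
    using ex_card_below[of "r ` F" "{y \<in> class_minima R. u y = l}" k] F(1) by blast
  then have "class_rank R u x = k"
    by (simp add: class_rank_def conj_ac)
  then show "(l, k) \<in> ranked_labels R u" using x unfolding ranked_labels_def by blast
qed

text \<open>The image under \<open>t\<close> of a witnessing set of inequivalent points is again
  witnessing, with the same cardinality.\<close>

lemma ranked_labels_mono:
  assumes R: "equivp R" "\<forall>x y. R x y \<longrightarrow> u x = u y"
    and R': "equivp R'" "\<forall>x y. R' x y \<longrightarrow> u' x = u' y"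
    and t: "\<And>x y. R' (t x) (t y) \<longleftrightarrow> R x y" "\<And>x. u' (t x) = u x"
  shows "ranked_labels R u \<subseteq> ranked_labels R' u'"
proof (rule subrelI)
  fix l k assume "(l, k) \<in> ranked_labels R u"
  from iffD1[OF mem_ranked_labels_iff[of R u, OF R] this]
  obtain F where F: "finite F" "card F = Suc k" "\<forall>x\<in>F. u x = l"
    "\<forall>x\<in>F. \<forall>y\<in>F. R x y \<longrightarrow> x = y" by (elim exE conjE) (rule that)
  have "inj_on t F"
  proof (rule inj_onI)
    fix x y assume *: "x \<in> F" "y \<in> F" "t x = t y"
    then have "R x y" using equivp_reflp[OF R'(1), of "t x"] t(1)[of x y] by simp
    with * F(4) show "x = y" by blast
  qed
  then have "finite (t ` F)" "card (t ` F) = Suc k" using F by (simp_all add: card_image)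
  moreover have "\<forall>x\<in>t ` F. u' x = l" using F(3) t(2) by simp
  moreover have "\<forall>x\<in>t ` F. \<forall>y\<in>t ` F. R' x y \<longrightarrow> x = y" using F(4) t(1) by auto
  ultimately show "(l, k) \<in> ranked_labels R' u'"
    by (intro iffD2[OF mem_ranked_labels_iff[of R' u', OF R']] exI[of _ "t ` F"] conjI)
qed

text \<open>Among representatives with the same label, the rank is strictly increasing.\<close>

lemma inj_on_ranked: "inj_on (\<lambda>x. (u x, class_rank R u x)) (class_minima R)"
proof -
  have less: "class_rank R u x < class_rank R u y"
    if "x \<in> class_minima R" "x < y" "u x = u y" for x y
    unfolding class_rank_def by (rule psubset_card_mono) (use that in auto)
  show ?thesis
    by (rule inj_onI) (metis (mono_tags, lifting) less less_irrefl nat_neq_iff prod.inject)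
qed

text \<open>Representatives with equal label and equal rank are matched with each other.\<close>

lemma ranked_labels_eqE:
  assumes eq: "ranked_labels R u = ranked_labels R' u'"
  obtains h where "bij_betw h (class_minima R) (class_minima R')"
    "\<forall>x\<in>class_minima R. u' (h x) = u x"
proof
  let ?r = "\<lambda>x. (u x, class_rank R u x)" and ?r' = "\<lambda>x. (u' x, class_rank R' u' x)"
  let ?h = "inv_into (class_minima R') ?r' \<circ> ?r"
  have "bij_betw ?r (class_minima R) (ranked_labels R' u')"
    "bij_betw ?r' (class_minima R') (ranked_labels R' u')"
    using eq by (simp_all add: bij_betw_def inj_on_ranked ranked_labels_def)
  then show "bij_betw ?h (class_minima R) (class_minima R')"
    by (intro bij_betw_trans[OF _ bij_betw_inv_into])
  show "\<forall>x\<in>class_minima R. u' (?h x) = u x"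
  proof
    fix x assume x: "x \<in> class_minima R"
    have "?r x \<in> ?r' ` class_minima R'" using x eq by (auto simp: ranked_labels_def)
    then have "?r' (?h x) = ?r x" unfolding o_apply by (rule f_inv_into_f)
    then show "u' (?h x) = u x" by simp
  qed
qed

subsection \<open>Conjugacy of automorphisms\<close>

abbreviation Aut :: "(nat \<times> nat \<Rightarrow> nat \<times> nat) set" where
  "Aut \<equiv> graph_automorphisms inf_K_inf"

text \<open>This is the induced action on copies. Vertex 0 is an arbitrary sample: for an
  automorphism every vertex of copy \<open>i\<close> lands in the same copy.\<close>

definition base :: "(nat \<times> nat \<Rightarrow> nat \<times> nat) \<Rightarrow> nat \<Rightarrow> nat" where
  "base \<phi> i = fst (\<phi> (i, 0))"

text \<open>Adjacent means distinct and in the same copy. Bijections preserve distinctness, so only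
  the relation of lying in the same copy remains.\<close>

lemma Aut_iff:
  "\<phi> \<in> Aut \<longleftrightarrow> bij \<phi> \<and> (\<forall>x y. fst (\<phi> x) = fst (\<phi> y) \<longleftrightarrow> fst x = fst y)"
proof -
  have adj: "inf_K_inf x y \<longleftrightarrow> fst x = fst y \<and> x \<noteq> y" for x y
    by (auto simp: inf_K_inf_def prod_eq_iff)
  have "inf_K_inf (\<phi> x) (\<phi> y) = inf_K_inf x y \<longleftrightarrow> (fst (\<phi> x) = fst (\<phi> y) \<longleftrightarrow> fst x = fst y)"
    if "bij \<phi>" for x y
    using that by (cases "x = y") (simp_all add: adj bij_is_inj inj_eq)
  then show ?thesis by (auto simp: graph_automorphisms_def)
qed

lemma
  assumes "\<phi> \<in> Aut"
  shows Aut_bij: "bij \<phi>" and Aut_inj: "inj \<phi>"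
    and Aut_fst: "fst (\<phi> x) = base \<phi> (fst x)"
    and Aut_base_inj: "inj (base \<phi>)"
    and Aut_base_bij: "bij (base \<phi>)"
proof -
  show "bij \<phi>" using assms by (simp add: Aut_iff)
  then show "inj \<phi>" by (rule bij_is_inj)
  show fst: "fst (\<phi> x) = base \<phi> (fst x)" for x
    using assms unfolding Aut_iff base_def by (metis fst_conv)
  show "inj (base \<phi>)"
    using assms unfolding Aut_iff base_def by (auto intro!: injI)
  moreover have "surj (base \<phi>)"
  proof (rule surjI)
    show "base \<phi> (fst (inv \<phi> (i, 0))) = i" for i
      using fst[of "inv \<phi> (i, 0)"] \<open>bij \<phi>\<close> by (simp add: bij_is_surj surj_f_inv_f)
  qed
  ultimately show "bij (base \<phi>)" by (simp add: bij_def)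
qed

lemma Aut_zpow:
  assumes "\<phi> \<in> Aut"
  shows "zpow \<phi> k \<in> Aut"
proof -
  have "\<phi> ^^ n \<in> Aut" if "\<phi> \<in> Aut" for \<phi> n
    using that by (induction n) (auto intro: graph_automorphisms_comp graph_automorphisms_id)
  then show ?thesis using assms by (simp add: zpow_def graph_automorphisms_inv)
qed

lemma fst_zpow:
  assumes "\<phi> \<in> Aut"
  shows "fst (zpow \<phi> k x) = zpow (base \<phi>) k (fst x)"
  by (rule zpow_semiconj) (simp_all add: assms Aut_bij Aut_base_bij Aut_fst fun_eq_iff)

text \<open>The intertwining equation is the form in which conjugacy enters
  \<open>zpow_semiconj\<close> and its consequences.\<close>

lemma conjugacy_Aut_iff:
  "(\<phi>, \<psi>) \<in> conjugacy Aut \<longleftrightarrow>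
    \<phi> \<in> Aut \<and> \<psi> \<in> Aut \<and> (\<exists>\<delta>\<in>Aut. \<delta> \<circ> \<phi> = \<psi> \<circ> \<delta>)"
proof -
  have "\<psi> = \<delta> \<circ> \<phi> \<circ> inv \<delta> \<longleftrightarrow> \<delta> \<circ> \<phi> = \<psi> \<circ> \<delta>" if "\<delta> \<in> Aut" for \<delta>
  proof
    assume "\<psi> = \<delta> \<circ> \<phi> \<circ> inv \<delta>"
    then show "\<delta> \<circ> \<phi> = \<psi> \<circ> \<delta>" using Aut_inj[OF that] by (simp add: comp_assoc)
  next
    assume "\<delta> \<circ> \<phi> = \<psi> \<circ> \<delta>"
    then have "\<delta> \<circ> \<phi> \<circ> inv \<delta> = \<psi> \<circ> \<delta> \<circ> inv \<delta>" by simp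
    then show "\<psi> = \<delta> \<circ> \<phi> \<circ> inv \<delta>"
      using bij_is_surj[OF Aut_bij[OF that]] by (simp add: comp_assoc surj_iff)
  qed
  then show ?thesis by (auto simp: conjugacy_def)
qed

section \<open>Labels of copies and their invariance under conjugacy\<close>

definition fibre_label :: "(nat \<times> nat \<Rightarrow> nat \<times> nat) \<Rightarrow> nat \<Rightarrow> (nat \<times> nat) set" where
  "fibre_label \<phi> i =
     ranked_labels (\<lambda>m m'. same_orbit \<phi> (i, m) (i, m')) (\<lambda>m. period \<phi> (i, m))"

definition component_label :: "(nat \<times> nat \<Rightarrow> nat \<times> nat) \<Rightarrow> nat \<Rightarrow> nat \<times> (nat \<times> nat) set" where
  "component_label \<phi> i = (period (base \<phi>) i, fibre_label \<phi> i)"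

abbreviation component_labels ::
    "(nat \<times> nat \<Rightarrow> nat \<times> nat) \<Rightarrow> ((nat \<times> (nat \<times> nat) set) \<times> nat) set" where
  "component_labels \<phi> \<equiv> ranked_labels (same_orbit (base \<phi>)) (component_label \<phi>)"

lemma equivp_fibre: "\<phi> \<in> Aut \<Longrightarrow> equivp (\<lambda>m m'. same_orbit \<phi> (i, m) (i, m'))"
  by (rule equivp_pullback[OF equivp_same_orbit[OF Aut_bij]])

text \<open>The map \<delta> sends copy \<open>i\<close> into copy \<open>base \<delta> i\<close>
  and preserves periods and the relation of lying in one orbit. Its second coordinate therefore
  embeds the classes of one fibre in those of the other; applied to \<open>inv \<delta>\<close>,
  this gives the reverse inclusion.\<close>

lemma fibre_label_mono:
  assumes "\<phi> \<in> Aut" "\<psi> \<in> Aut" "\<delta> \<in> Aut"  "\<delta> \<circ> \<phi> = \<psi> \<circ> \<delta>"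
  shows "fibre_label \<phi> i \<subseteq> fibre_label \<psi> (base \<delta> i)"
  unfolding fibre_label_def
proof (rule ranked_labels_mono)
  have *: "(base \<delta> i, snd (\<delta> (i, m))) = \<delta> (i, m)" for m
    using Aut_fst[OF assms(3), of "(i, m)"] by (simp add: prod_eq_iff)
  fix m m'
  show "same_orbit \<psi> (base \<delta> i, snd (\<delta> (i, m))) (base \<delta> i, snd (\<delta> (i, m'))) \<longleftrightarrow>
      same_orbit \<phi> (i, m) (i, m')"
    unfolding * by (rule semiconj_same_orbit) (simp_all add: assms Aut_bij Aut_inj)
  show "period \<psi> (base \<delta> i, snd (\<delta> (i, m))) = period \<phi> (i, m)"
    unfolding * by (rule semiconj_period) (simp_all add: assms Aut_bij Aut_inj)
qed (simp_all add: assms equivp_fibre same_orbit_period Aut_bij)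

lemma semiconj_inv:
  assumes "\<delta> \<in> Aut" "\<delta> \<circ> \<phi> = \<psi> \<circ> \<delta>"
  shows "inv \<delta> \<in> Aut" "inv \<delta> \<circ> \<psi> = \<phi> \<circ> inv \<delta>" "base (inv \<delta>) (base \<delta> i) = i"
proof -
  show inv: "inv \<delta> \<in> Aut" by (rule graph_automorphisms_inv[OF assms(1)])
  have "inv \<delta> \<circ> (\<delta> \<circ> \<phi>) \<circ> inv \<delta> = inv \<delta> \<circ> (\<psi> \<circ> \<delta>) \<circ> inv \<delta>" by (simp add: assms(2))
  then show "inv \<delta> \<circ> \<psi> = \<phi> \<circ> inv \<delta>"
    using Aut_bij[OF assms(1)] by (simp add: fun_eq_iff bij_is_inj bij_is_surj surj_f_inv_f)
  have "base (inv \<delta>) (base \<delta> i) = fst (inv \<delta> (\<delta> (i, 0)))"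
    using Aut_fst[OF inv, of "\<delta> (i, 0)"] by (simp add: base_def)
  then show "base (inv \<delta>) (base \<delta> i) = i"
    by (simp add: Aut_inj[OF assms(1)])
qed

lemma fibre_label_eq:
  assumes "\<phi> \<in> Aut" "\<psi> \<in> Aut" "\<delta> \<in> Aut" "\<delta> \<circ> \<phi> = \<psi> \<circ> \<delta>"
  shows "fibre_label \<psi> (base \<delta> i) = fibre_label \<phi> i"
  using fibre_label_mono[OF assms, of i]
    fibre_label_mono[OF assms(2,1) semiconj_inv(1,2)[OF assms(3,4)], of "base \<delta> i"]
  by (simp add: semiconj_inv(3)[OF assms(3,4)])

lemma base_semiconj:
  assumes "\<phi> \<in> Aut" "\<psi> \<in> Aut" "\<delta> \<in> Aut" "\<delta> \<circ> \<phi> = \<psi> \<circ> \<delta>"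
  shows "base \<delta> \<circ> base \<phi> = base \<psi> \<circ> base \<delta>"
proof -
  have "fst ((\<delta> \<circ> \<phi>) (i, 0)) = fst ((\<psi> \<circ> \<delta>) (i, 0))" for i by (simp add: assms(4))
  then show ?thesis by (simp add: Aut_fst assms(1-3) fun_eq_iff)
qed

lemma component_label_eq:
  assumes "\<phi> \<in> Aut" "\<psi> \<in> Aut" "\<delta> \<in> Aut" "\<delta> \<circ> \<phi> = \<psi> \<circ> \<delta>"
  shows "component_label \<psi> (base \<delta> i) = component_label \<phi> i"
  using fibre_label_eq[OF assms] semiconj_period[of "base \<phi>" "base \<psi>" "base \<delta>" i]
  by (simp add: component_label_def assms Aut_base_bij Aut_base_inj base_semiconj[OF assms])

text \<open>A power of \<phi> that moves \<open>i\<close> to \<open>j\<close> commutes with \<phi>,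
  so it conjugates \<phi> to itself and preserves labels.\<close>

lemma same_orbit_component_label:
  assumes "\<phi> \<in> Aut" "same_orbit (base \<phi>) i j"
  shows "component_label \<phi> i = component_label \<phi> j"
proof -
  obtain k where "zpow (base \<phi>) k i = j" using assms(2) by (auto simp: same_orbit_def)
  then have "j = base (zpow \<phi> k) i" by (simp add: base_def fst_zpow[OF assms(1)])
  then show ?thesis
    using component_label_eq[OF assms(1,1) Aut_zpow zpow_commute] assms(1) Aut_bij by simp
qed

lemma component_labels_mono:
  assumes "\<phi> \<in> Aut" "\<psi> \<in> Aut" "\<delta> \<in> Aut" "\<delta> \<circ> \<phi> = \<psi> \<circ> \<delta>"
  shows "component_labels \<phi> \<subseteq> component_labels \<psi>"
proof (rule ranked_labels_mono)
  show "same_orbit (base \<psi>) (base \<delta> i) (base \<delta> j) \<longleftrightarrow> same_orbit (base \<phi>) i j" for i j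
    by (rule semiconj_same_orbit)
      (simp_all add: assms Aut_base_bij Aut_base_inj base_semiconj[OF assms])
  show "component_label \<psi> (base \<delta> i) = component_label \<phi> i" for i
    by (rule component_label_eq[OF assms])
qed (simp_all add: assms equivp_same_orbit Aut_base_bij same_orbit_component_label)

lemma component_labels_eq_if_conjugate:
  assumes "(\<phi>, \<psi>) \<in> conjugacy Aut"
  shows "component_labels \<phi> = component_labels \<psi>"
proof -
  obtain \<delta> where *: "\<phi> \<in> Aut" "\<psi> \<in> Aut" "\<delta> \<in> Aut" "\<delta> \<circ> \<phi> = \<psi> \<circ> \<delta>"
    using assms by (auto simp: conjugacy_Aut_iff)
  show ?thesis
    using component_labels_mono[OF *] component_labels_mono[OF *(2,1) semiconj_inv(1,2)[OF *(3,4)]]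
    by blast
qed

section \<open>Conjugacy from equality of labels\<close>

definition orbit_reps :: "(nat \<times> nat \<Rightarrow> nat \<times> nat) \<Rightarrow> (nat \<times> nat) set" where
  "orbit_reps \<phi> = Sigma (class_minima (same_orbit (base \<phi>)))
     (\<lambda>i. class_minima (\<lambda>m m'. same_orbit \<phi> (i, m) (i, m')))"

text \<open>Some power of \<phi> moves \<open>x\<close> into the least copy of its orbit of copies,
  where the minimum of its class is taken. Representatives in one orbit share their copy and then
  their vertex.\<close>

lemma transversal_orbit_reps:
  assumes \<phi>: "\<phi> \<in> Aut"
  shows "transversal \<phi> (orbit_reps \<phi>)"
  unfolding transversal_def
proof
  note equiv = equivp_same_orbit[OF Aut_bij[OF \<phi>]]
  note base_equiv = equivp_same_orbit[OF Aut_base_bij[OF \<phi>]]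
  fix x
  show "\<exists>!y. y \<in> orbit_reps \<phi> \<and> same_orbit \<phi> y x"
  proof (rule ex_ex1I)
    obtain i where i: "i \<in> class_minima (same_orbit (base \<phi>))" "same_orbit (base \<phi>) i (fst x)"
      using class_minima_ex[OF base_equiv] .
    then obtain k where k: "zpow (base \<phi>) k (fst x) = i"
      using equivp_symp[OF base_equiv i(2)] by (auto simp: same_orbit_def)
    let ?m = "snd (zpow \<phi> k x)"
    have x: "zpow \<phi> k x = (i, ?m)" using k by (simp add: prod_eq_iff fst_zpow[OF \<phi>])
    obtain m where m: "m \<in> class_minima (\<lambda>m m'. same_orbit \<phi> (i, m) (i, m'))"
      "same_orbit \<phi> (i, m) (i, ?m)"
      using class_minima_ex[OF equivp_fibre[OF \<phi>]] .
    have "same_orbit \<phi> x (i, ?m)" using x unfolding same_orbit_def by blast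
    then have "same_orbit \<phi> (i, m) x"
      using m(2) equivp_symp[OF equiv] equivp_transp[OF equiv] by blast
    then show "\<exists>y. y \<in> orbit_reps \<phi> \<and> same_orbit \<phi> y x"
      using i(1) m(1) unfolding orbit_reps_def by blast
  next
    fix y z
    assume y: "y \<in> orbit_reps \<phi> \<and> same_orbit \<phi> y x" and z: "z \<in> orbit_reps \<phi> \<and> same_orbit \<phi> z x"
    then have "same_orbit \<phi> y z" using equivp_symp[OF equiv] equivp_transp[OF equiv] by blast
    moreover from this have "same_orbit (base \<phi>) (fst y) (fst z)"
      by (auto simp: same_orbit_def fst_zpow[OF \<phi>])
    then have "fst y = fst z"
      using class_minima_unique[OF base_equiv] y z by (auto simp: orbit_reps_def)
    ultimately show "y = z"
      using class_minima_unique[OF equivp_fibre[OF \<phi>]] y z by (auto simp: orbit_reps_def)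
  qed
qed

text \<open>Equal ranked labels match copies through \<open>h\<close>, and vertices inside matched
  copies through \<open>g\<close>. Vertex periods make the extension \<delta> well defined; periods
  of copies make it respect copies.\<close>

lemma conjugate_if_component_labels_eq:
  assumes \<phi>: "\<phi> \<in> Aut" and \<psi>: "\<psi> \<in> Aut" and eq: "component_labels \<phi> = component_labels \<psi>"
  shows "(\<phi>, \<psi>) \<in> conjugacy Aut"
proof -
  let ?B = "\<lambda>\<phi>. class_minima (same_orbit (base \<phi>))"
  let ?A = "\<lambda>\<phi> i. class_minima (\<lambda>m m'. same_orbit \<phi> (i, m) (i, m'))"
  obtain h where h: "bij_betw h (?B \<phi>) (?B \<psi>)"
    and hl: "\<forall>i\<in>?B \<phi>. component_label \<psi> (h i) = component_label \<phi> i"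
    using ranked_labels_eqE[OF eq] .
  have "\<exists>g. bij_betw g (?A \<phi> i) (?A \<psi> (h i)) \<and>
      (\<forall>m\<in>?A \<phi> i. period \<psi> (h i, g m) = period \<phi> (i, m))" if "i \<in> ?B \<phi>" for i
  proof -
    have "fibre_label \<phi> i = fibre_label \<psi> (h i)"
      using bspec[OF hl that] by (simp add: component_label_def)
    from ranked_labels_eqE[OF this[unfolded fibre_label_def]] obtain g
      where "bij_betw g (?A \<phi> i) (?A \<psi> (h i))"
        "\<forall>m\<in>?A \<phi> i. period \<psi> (h i, g m) = period \<phi> (i, m)" .
    then show ?thesis by blast
  qed
  then obtain g where g: "\<And>i. i \<in> ?B \<phi> \<Longrightarrow> bij_betw (g i) (?A \<phi> i) (?A \<psi> (h i))"
    and gp: "\<And>i m. i \<in> ?B \<phi> \<Longrightarrow> m \<in> ?A \<phi> i \<Longrightarrow> period \<psi> (h i, g i m) = period \<phi> (i, m)"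
    by metis
  let ?G = "\<lambda>(i, m). (h i, g i m)"
  have h_eq: "h i = h j \<longleftrightarrow> i = j" if "i \<in> ?B \<phi>" "j \<in> ?B \<phi>" for i j
    using h that by (meson bij_betw_imp_inj_on inj_on_eq_iff)
  have G: "bij_betw ?G (orbit_reps \<phi>) (orbit_reps \<psi>)"
  proof (rule bij_betwI')
    fix x y assume "x \<in> orbit_reps \<phi>" "y \<in> orbit_reps \<phi>"
    moreover have "g i m = g i m' \<longleftrightarrow> m = m'" if "i \<in> ?B \<phi>" "m \<in> ?A \<phi> i" "m' \<in> ?A \<phi> i" for i m m'
      using g[OF that(1)] that(2,3) by (meson bij_betw_imp_inj_on inj_on_eq_iff)
    ultimately show "?G x = ?G y \<longleftrightarrow> x = y" by (auto simp: orbit_reps_def h_eq)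
  next
    fix x assume "x \<in> orbit_reps \<phi>"
    then show "?G x \<in> orbit_reps \<psi>"
      using bij_betw_apply[OF h] bij_betw_apply[OF g] by (auto simp: orbit_reps_def)
  next
    fix y assume "y \<in> orbit_reps \<psi>"
    then obtain j n where y: "y = (j, n)" "j \<in> ?B \<psi>" "n \<in> ?A \<psi> j" by (auto simp: orbit_reps_def)
    then obtain i where i: "i \<in> ?B \<phi>" "j = h i" using h by (auto simp: bij_betw_def)
    then obtain m where "m \<in> ?A \<phi> i" "n = g i m" using g[OF i(1)] y(3) by (auto simp: bij_betw_def)
    then show "\<exists>x\<in>orbit_reps \<phi>. y = ?G x"
      using i y(1) by (intro bexI[of _ "(i, m)"]) (auto simp: orbit_reps_def)
  qed
  have per: "period \<psi> (?G y) = period \<phi> y" if "y \<in> orbit_reps \<phi>" for y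
    using that gp by (auto simp: orbit_reps_def)
  obtain \<delta> where \<delta>: "bij \<delta>" "\<And>y k. y \<in> orbit_reps \<phi> \<Longrightarrow> \<delta> (zpow \<phi> k y) = zpow \<psi> k (?G y)"
    using extend_equivariantly_bij[OF Aut_bij[OF \<phi>] Aut_bij[OF \<psi>] transversal_orbit_reps[OF \<phi>]
        transversal_orbit_reps[OF \<psi>] G per] by metis
  \<comment> \<open>Every point is an iterate of a representative, and applying \<phi> or \<psi>
    raises the exponent by one.\<close>
  have "\<delta> \<circ> \<phi> = \<psi> \<circ> \<delta>"
  proof
    fix x
    obtain y k where y: "y \<in> orbit_reps \<phi>" "x = zpow \<phi> k y"
      using transversalE[OF transversal_orbit_reps[OF \<phi>]] .
    then show "(\<delta> \<circ> \<phi>) x = (\<psi> \<circ> \<delta>) x"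
      using \<delta>(2)[OF y(1), of "k + 1"] \<delta>(2)[OF y(1), of k]
      by (simp add: zpow_succ Aut_bij \<phi> \<psi>)
  qed
  moreover have "fst (\<delta> x) = fst (\<delta> x') \<longleftrightarrow> fst x = fst x'" for x x'
  proof -
    obtain y k where y: "y \<in> orbit_reps \<phi>" "x = zpow \<phi> k y"
      using transversalE[OF transversal_orbit_reps[OF \<phi>]] .
    obtain y' k' where y': "y' \<in> orbit_reps \<phi>" "x' = zpow \<phi> k' y'"
      using transversalE[OF transversal_orbit_reps[OF \<phi>]] .
    have B: "fst y \<in> ?B \<phi>" "fst y' \<in> ?B \<phi>" "h (fst y) \<in> ?B \<psi>" "h (fst y') \<in> ?B \<psi>"
      using y(1) y'(1) bij_betw_apply[OF h] by (auto simp: orbit_reps_def)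
    have same: "i = j"
      if "i \<in> ?B \<theta>" "j \<in> ?B \<theta>" "zpow (base \<theta>) k i = zpow (base \<theta>) k' j" "\<theta> \<in> Aut" for \<theta> i j
    proof -
      note E = equivp_same_orbit[OF Aut_base_bij[OF that(4)]]
      have "same_orbit (base \<theta>) i (zpow (base \<theta>) k i)" "same_orbit (base \<theta>) j (zpow (base \<theta>) k i)"
        using that(3) unfolding same_orbit_def by metis+
      then have "same_orbit (base \<theta>) i j" using equivp_symp[OF E] equivp_transp[OF E] by blast
      then show ?thesis using class_minima_unique[OF E that(1,2)] by blast
    qed
    \<comment> \<open>Lying in the same copy is reduced to equality of the representing copies and a
      divisibility by their period. The map \<open>h\<close> preserves both conditions.\<close>
    have "fst x = fst x' \<longleftrightarrow> zpow (base \<phi>) k (fst y) = zpow (base \<phi>) k' (fst y')"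
      by (simp add: y y' fst_zpow[OF \<phi>])
    also have "\<dots> \<longleftrightarrow> fst y = fst y' \<and> int (period (base \<phi>) (fst y)) dvd k - k'"
      using same[OF B(1,2) _ \<phi>]
        zpow_eq_iff_period[OF Aut_base_bij[OF \<phi>], of k "fst y" k'] by metis
    also have "\<dots> \<longleftrightarrow> h (fst y) = h (fst y') \<and> int (period (base \<psi>) (h (fst y))) dvd k - k'"
      using bspec[OF hl B(1)] by (simp add: component_label_def h_eq B)
    also have "\<dots> \<longleftrightarrow> zpow (base \<psi>) k (h (fst y)) = zpow (base \<psi>) k' (h (fst y'))"
      using same[OF B(3,4) _ \<psi>]
        zpow_eq_iff_period[OF Aut_base_bij[OF \<psi>], of k "h (fst y)" k'] by metis
    also have "\<dots> \<longleftrightarrow> fst (\<delta> x) = fst (\<delta> x')"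
      by (simp add: y y' \<delta>(2) fst_zpow[OF \<psi>] split_beta)
    finally show ?thesis by simp
  qed
  ultimately show ?thesis
    using \<delta>(1) \<phi> \<psi> unfolding conjugacy_Aut_iff by (metis Aut_iff)
qed

subsection \<open>Coding the invariant by reals\<close>

text \<open>Base 3 with digits 0 and 1 avoids the double expansions of base 2: all later digits
  together contribute at most half of the current place value.\<close>

definition set_code :: "nat set \<Rightarrow> real" where
  "set_code A = (\<Sum>k. if k \<in> A then (1/3) ^ k else 0)"

lemma summable_set_code: "summable (\<lambda>k. if k \<in> A then (1/3) ^ k else (0::real))"
  by (rule summable_comparison_test'[of "\<lambda>k. (1/3::real) ^ k" 0]) (auto intro: summable_geometric)

lemma set_code_nonneg: "0 \<le> set_code A"
  unfolding set_code_def by (rule suminf_nonneg[OF summable_set_code]) simp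

lemma set_code_le: "set_code A \<le> 3 / 2"
proof -
  have "set_code A \<le> (\<Sum>k. (1/3::real) ^ k)"
    unfolding set_code_def by (rule suminf_le[OF _ summable_set_code])
      (auto intro: summable_geometric)
  also have "\<dots> = 3 / 2" by (simp add: suminf_geometric)
  finally show ?thesis .
qed

lemma set_code_shift: "set_code A = (if 0 \<in> A then 1 else 0) + set_code {k. Suc k \<in> A} / 3"
proof -
  have "set_code A = (if 0 \<in> A then 1 else 0) + (\<Sum>k. if Suc k \<in> A then (1/3) ^ Suc k else 0)"
    using suminf_split_head[OF summable_set_code[of A]] by (simp add: set_code_def)
  also have "(\<Sum>k. if Suc k \<in> A then (1/3::real) ^ Suc k else 0)
      = (\<Sum>k. (if k \<in> {k. Suc k \<in> A} then (1/3) ^ k else 0) * (1/3))"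
    by (intro arg_cong[where f = suminf]) auto
  also have "\<dots> = set_code {k. Suc k \<in> A} / 3"
    unfolding set_code_def by (subst suminf_mult2[OF summable_set_code, symmetric]) simp
  finally show ?thesis .
qed

text \<open>Without the leading digit the sum is at most 1/2; with it, at least 1.\<close>

lemma zero_mem_iff_set_code: "0 \<in> A \<longleftrightarrow> 1 \<le> set_code A"
  using set_code_shift[of A] set_code_nonneg[of "{k. Suc k \<in> A}"] set_code_le[of "{k. Suc k \<in> A}"]
  by (auto split: if_splits)

text \<open>The leading digit can be read off. Removing it and shifting reduces digit
  \<open>Suc k\<close> to digit \<open>k\<close>.\<close>

lemma inj_set_code: "inj set_code"
proof (rule injI, rule set_eqI)
  fix A B k
  assume "set_code A = set_code B"
  then show "k \<in> A \<longleftrightarrow> k \<in> B"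
  proof (induction k arbitrary: A B)
    case 0
    then show ?case by (simp add: zero_mem_iff_set_code)
  next
    case (Suc k)
    then have "0 \<in> A \<longleftrightarrow> 0 \<in> B" by (simp add: zero_mem_iff_set_code)
    then have "set_code {k. Suc k \<in> A} = set_code {k. Suc k \<in> B}"
      using Suc.prems set_code_shift[of A] set_code_shift[of B] by (simp split: if_splits)
    from Suc.IH[OF this] show ?case by simp
  qed
qed

section \<open>Measurability of orbits, labels and ranks\<close>

lemma measurable_set_code:
  assumes [measurable]: "\<And>k. Measurable.pred M (\<lambda>x. k \<in> A x)"
  shows "(\<lambda>x. set_code (A x)) \<in> borel_measurable M"
  unfolding set_code_def by measurable

text \<open>Labels enter only through equality between indices. Hence the lemma also applies to
  set-valued labels such as \<open>component_label\<close>, with no measurable structure on the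
  label type.\<close>

lemma measurable_ranked:
  assumes [measurable]: "\<And>x y. Measurable.pred M (\<lambda>w. R w x y)"
    "\<And>x y. Measurable.pred M (\<lambda>w. u w x = u w y)"
  shows pred_class_minima: "Measurable.pred M (\<lambda>w. x \<in> class_minima (R w))"
    and measurable_class_rank: "(\<lambda>w. class_rank (R w) (u w) x) \<in> M \<rightarrow>\<^sub>M count_space UNIV"
proof -
  show [measurable]: "Measurable.pred M (\<lambda>w. x \<in> class_minima (R w))" for x
    unfolding class_minima_def mem_Collect_eq by measurable
  show "(\<lambda>w. class_rank (R w) (u w) x) \<in> M \<rightarrow>\<^sub>M count_space UNIV"
    unfolding class_rank_def by measurable
qed

lemma pred_ranked_labels:
  assumes [measurable]: "\<And>x y. Measurable.pred M (\<lambda>w. R w x y)"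
    "\<And>x y. Measurable.pred M (\<lambda>w. u w x = u w y)"
    "\<And>x l. Measurable.pred M (\<lambda>w. u w x = l)"
  shows "Measurable.pred M (\<lambda>w. z \<in> ranked_labels (R w) (u w))"
proof -
  note [measurable] = measurable_ranked[OF assms(1,2)]
  have "z \<in> ranked_labels (R w) (u w) \<longleftrightarrow>
      (\<exists>x. x \<in> class_minima (R w) \<and> u w x = fst z \<and> class_rank (R w) (u w) x = snd z)" for w
    by (cases z) (auto simp: ranked_labels_def image_iff)
  then show ?thesis by simp
qed

lemma measurable_apply_Aut [measurable]:
  "(\<lambda>\<phi>. \<phi> x) \<in> aut_inf_K_inf \<rightarrow>\<^sub>M count_space UNIV"
proof -
  have "sets (count_space UNIV) = sets (borel :: (nat \<times> nat) measure)"
    using open_nat_prod by (auto intro: borel_open)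
  moreover have "(\<lambda>\<phi>. \<phi> x) \<in> aut_inf_K_inf \<rightarrow>\<^sub>M borel"
    unfolding aut_inf_K_inf_def by (rule measurable_restrict_space1) simp
  ultimately show ?thesis using measurable_cong_sets[OF refl] by blast
qed

lemma measurable_funpow_Aut [measurable]:
  "(\<lambda>\<phi>. (\<phi> ^^ n) x) \<in> aut_inf_K_inf \<rightarrow>\<^sub>M count_space UNIV"
proof (induction n)
  case 0
  show ?case by simp
next
  case (Suc n)
  \<comment> \<open>The point at which \<phi> is evaluated depends on \<phi> itself; it takes only
    countably many values.\<close>
  show ?case
    using measurable_compose_countable[OF measurable_apply_Aut Suc, of "\<lambda>y. y"] by simp
qed

lemma pred_zpow_Aut: "Measurable.pred aut_inf_K_inf (\<lambda>\<phi>. zpow \<phi> k x = y)"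
proof (cases "k \<ge> 0")
  case True
  then show ?thesis by (simp add: zpow_def)
next
  case False
  \<comment> \<open>For negative \<open>k\<close> the equation is solved for \<open>x\<close>, so
    that only forward iterates of \<phi> need to be measurable.\<close>
  have "zpow \<phi> k x = y \<longleftrightarrow> (\<phi> ^^ nat (- k)) y = x" if "\<phi> \<in> space aut_inf_K_inf" for \<phi>
  proof -
    have "bij \<phi>" using that by (simp add: space_aut_inf_K_inf Aut_bij)
    from zpow_minus_cancel[OF this] have "zpow \<phi> k x = y \<longleftrightarrow> zpow \<phi> (- k) y = x" by metis
    then show ?thesis using False by (simp add: zpow_def)
  qed
  moreover have "Measurable.pred aut_inf_K_inf (\<lambda>\<phi>. (\<phi> ^^ nat (- k)) y = x)" by measurable
  ultimately show ?thesis by (rule iffD2[OF measurable_cong])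
qed

lemma measurable_zpow_Aut [measurable]:
  "(\<lambda>\<phi>. zpow \<phi> k x) \<in> aut_inf_K_inf \<rightarrow>\<^sub>M count_space UNIV"
proof -
  have "(\<lambda>\<phi>. zpow \<phi> k x) -` {y} \<inter> space aut_inf_K_inf =
      {\<phi> \<in> space aut_inf_K_inf. zpow \<phi> k x = y}" for y
    by auto
  moreover have "{\<phi> \<in> space aut_inf_K_inf. zpow \<phi> k x = y} \<in> sets aut_inf_K_inf" for y
    using pred_zpow_Aut by (rule predE)
  ultimately show ?thesis by (simp add: measurable_count_space_eq2_countable)
qed

text \<open>On automorphisms, iterates of the action on copies are read off from iterates of the
  vertex \<open>(i, 0)\<close>.\<close>

lemma measurable_zpow_base [measurable]:
  "(\<lambda>\<phi>. zpow (base \<phi>) k i) \<in> aut_inf_K_inf \<rightarrow>\<^sub>M count_space UNIV"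
proof -
  have "(\<lambda>\<phi>. fst (zpow \<phi> k (i, 0))) \<in> aut_inf_K_inf \<rightarrow>\<^sub>M count_space UNIV"
    by (rule measurable_compose[OF measurable_zpow_Aut]) simp
  moreover have "zpow (base \<phi>) k i = fst (zpow \<phi> k (i, 0))" if "\<phi> \<in> space aut_inf_K_inf" for \<phi>
    using that by (simp add: fst_zpow space_aut_inf_K_inf)
  ultimately show ?thesis by (rule iffD2[OF measurable_cong, rotated])
qed

lemma measurable_orbits [measurable]:
  "Measurable.pred aut_inf_K_inf (\<lambda>\<phi>. same_orbit \<phi> x y)"
  "Measurable.pred aut_inf_K_inf (\<lambda>\<phi>. same_orbit (base \<phi>) i j)"
  "(\<lambda>\<phi>. period \<phi> x) \<in> aut_inf_K_inf \<rightarrow>\<^sub>M count_space UNIV"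
  "(\<lambda>\<phi>. period (base \<phi>) i) \<in> aut_inf_K_inf \<rightarrow>\<^sub>M count_space UNIV"
  unfolding same_orbit_def period_def by measurable

lemma pred_fibre_label [measurable]: "Measurable.pred aut_inf_K_inf (\<lambda>\<phi>. z \<in> fibre_label \<phi> i)"
  unfolding fibre_label_def by (rule pred_ranked_labels) measurable

lemma pred_component_label_eq [measurable]:
  "Measurable.pred aut_inf_K_inf (\<lambda>\<phi>. component_label \<phi> i = component_label \<phi> j)"
  unfolding component_label_def prod.inject set_eq_iff by measurable

lemmas measurable_component_rank [measurable] =
  measurable_ranked[where M = aut_inf_K_inf and R = "\<lambda>\<phi>. same_orbit (base \<phi>)"
      and u = component_label,
    OF measurable_orbits(2) pred_component_label_eq]

text \<open>The product with two singletons turns a label and its rank into one subset of a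
  countable type. It can be decoded as long as \<open>S\<close> is nonempty.\<close>

fun label_code :: "(nat \<times> (nat \<times> nat) set) \<times> nat \<Rightarrow> real" where
  "label_code ((n, S), r) = set_code (to_nat ` ({n} \<times> S \<times> {r}))"

definition component_code :: "(nat \<times> nat \<Rightarrow> nat \<times> nat) \<Rightarrow> nat \<Rightarrow> real" where
  "component_code \<phi> i = label_code
     (component_label \<phi> i, class_rank (same_orbit (base \<phi>)) (component_label \<phi>) i)"

text \<open>Index 0 is always a class minimum, so using it as default for the other indices adds
  nothing to the range.\<close>

definition codes :: "(nat \<times> nat \<Rightarrow> nat \<times> nat) \<Rightarrow> nat \<Rightarrow> real" where
  "codes \<phi> i = component_code \<phi> (if i \<in> class_minima (same_orbit (base \<phi>)) then i else 0)"

lemma inj_on_label_code: "inj_on label_code {((n, S), r). S \<noteq> {}}"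
proof -
  have "n = n' \<and> S = S' \<and> r = r'"
    if "label_code ((n, S), r) = label_code ((n', S'), r')" "S \<noteq> {}" "S' \<noteq> {}" for n n' r r' S S'
  proof -
    have "{n} \<times> S \<times> {r} = {n'} \<times> S' \<times> {r'}"
      using that(1) inj_set_code by (simp add: inj_eq inj_image_eq_iff)
    with that show ?thesis by (auto simp: times_eq_iff)
  qed
  then show ?thesis by (auto simp: inj_on_def)
qed

lemma range_codes: "range (codes \<phi>) = label_code ` component_labels \<phi>"
proof -
  have "range (codes \<phi>) = component_code \<phi> ` class_minima (same_orbit (base \<phi>))"
    by (auto simp: codes_def image_iff)
  then show ?thesis by (auto simp: component_code_def ranked_labels_def image_image)
qed

text \<open>Vertex 0 of each copy is the minimum of its class, so no fibre label is empty and
  \<open>label_code\<close> is injective on the labels that occur.\<close>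

lemma component_labels_nonempty: "component_labels \<phi> \<subseteq> {((n, S), r). S \<noteq> {}}"
  by (auto simp: ranked_labels_def component_label_def fibre_label_def)

lemma codes_E_set_iff: "(codes \<phi>, codes \<psi>) \<in> E_set \<longleftrightarrow> component_labels \<phi> = component_labels \<psi>"
  by (simp add: E_set_def range_codes
      inj_on_image_eq_iff[OF inj_on_label_code component_labels_nonempty component_labels_nonempty])

lemma measurable_component_code [measurable]:
  "(\<lambda>\<phi>. component_code \<phi> i) \<in> borel_measurable aut_inf_K_inf"
proof -
  let ?r = "\<lambda>\<phi>. class_rank (same_orbit (base \<phi>)) (component_label \<phi>) i"
  let ?T = "\<lambda>\<phi>. {period (base \<phi>) i} \<times> fibre_label \<phi> i \<times> {?r \<phi>}"
  \<comment> \<open>Membership becomes a quantification over countable types of measurable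
    conditions.\<close>
  have "k \<in> to_nat ` ?T \<phi> \<longleftrightarrow> (\<exists>n s r. period (base \<phi>) i = n \<and> s \<in> fibre_label \<phi> i \<and> ?r \<phi> = r \<and>
      k = to_nat (n, s, r))" for k \<phi>
    by auto
  then have "Measurable.pred aut_inf_K_inf (\<lambda>\<phi>. k \<in> to_nat ` ?T \<phi>)" for k
    by (simp only:) measurable
  moreover have "component_code \<phi> i = set_code (to_nat ` ?T \<phi>)" for \<phi>
    by (simp add: component_code_def component_label_def[of \<phi> i])
  ultimately show ?thesis by (simp only: measurable_set_code)
qed

lemma measurable_codes: "codes \<in> aut_inf_K_inf \<rightarrow>\<^sub>M borel"
  unfolding codes_def by (rule measurable_coordinatewise_then_product) simp

lemma conjugacy_reducible_E_set:
  "borel_reducible aut_inf_K_inf (conjugacy Aut) (borel :: (nat \<Rightarrow> real) measure) E_set"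
  unfolding borel_reducible_def
proof (intro bexI[OF _ measurable_codes] ballI)
  fix \<phi> \<psi> assume "\<phi> \<in> space aut_inf_K_inf" "\<psi> \<in> space aut_inf_K_inf"
  then have "\<phi> \<in> Aut" "\<psi> \<in> Aut" by (simp_all add: space_aut_inf_K_inf)
  then show "(\<phi>, \<psi>) \<in> conjugacy Aut \<longleftrightarrow> (codes \<phi>, codes \<psi>) \<in> E_set"
    unfolding codes_E_set_iff
    using conjugate_if_component_labels_eq component_labels_eq_if_conjugate by blast
qed

subsection \<open>From sequences of reals to automorphisms\<close>

text \<open>This is the lower Dedekind cut of \<open>r\<close>, along the enumeration
  \<open>from_nat\<close> of the rationals.\<close>

definition below :: "real \<Rightarrow> nat \<Rightarrow> bool" where
  "below r k \<longleftrightarrow> real_of_rat (from_nat k) < r"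

lemma below_inj:
  assumes "\<And>k. below r k \<longleftrightarrow> below s k"
  shows "r = s"
proof -
  have *: "real_of_rat q < r \<longleftrightarrow> real_of_rat q < s" for q
    using assms[of "to_nat q"] by (simp add: below_def)
  have "\<not> r < s" "\<not> s < r"
    using of_rat_dense[of r s] of_rat_dense[of s r] * by (meson less_asym)+
  then show ?thesis by simp
qed

text \<open>Column \<open>k\<close> of the pairing carries at most one nontrivial cycle. Lengths
  start at 2 so that the fixed points, which fill the rest, are never mistaken for a coded
  rational.\<close>

definition real_perm :: "real \<Rightarrow> nat \<Rightarrow> nat" where
  "real_perm r m = (case prod_decode m of (k, l) \<Rightarrow>
     if below r k \<and> l < k + 2 then prod_encode (k, Suc l mod (k + 2)) else m)"

lemma real_perm_funpow:
  "(real_perm r ^^ j) (prod_encode (k, l)) =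
    (if below r k \<and> l < k + 2 then prod_encode (k, (l + j) mod (k + 2)) else prod_encode (k, l))"
proof (induction j)
  case (Suc j)
  have "(l + j) mod (k + 2) < k + 2" by simp
  then show ?case using Suc by (simp add: real_perm_def mod_Suc_eq)
qed simp

lemma add_mod_eq_self_iff:
  assumes "l < n"
  shows "(l + j) mod n = l \<longleftrightarrow> n dvd (j::nat)"
proof -
  have "(l + j) mod n = l mod n \<longleftrightarrow> n dvd j"
    by (metis add.commute add_diff_cancel_right' le_add2 mod_eq_dvd_iff_nat)
  then show ?thesis using assms by simp
qed

lemma real_perm_funpow_fixed_iff:
  "(real_perm r ^^ j) (prod_encode (k, l)) = prod_encode (k, l) \<longleftrightarrow>
    (below r k \<and> l < k + 2 \<longrightarrow> k + 2 dvd j)"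
  using add_mod_eq_self_iff[of l "k + 2" j]
  by (cases "below r k \<and> l < k + 2")
    (simp_all only: real_perm_funpow if_True if_False prod_encode_eq prod.inject simp_thms)

text \<open>The right-hand side says that some point has period \<open>k + 2\<close>; thus the cut,
  and with it \<open>r\<close>, can be recovered from the cycle lengths.\<close>

lemma below_iff_cycle:
  "below r k \<longleftrightarrow> (\<exists>m. \<forall>j. (real_perm r ^^ j) m = m \<longleftrightarrow> k + 2 dvd j)"
proof
  assume "below r k"
  then show "\<exists>m. \<forall>j. (real_perm r ^^ j) m = m \<longleftrightarrow> k + 2 dvd j"
    by (intro exI[of _ "prod_encode (k, 0)"]) (simp add: real_perm_funpow_fixed_iff)
next
  assume "\<exists>m. \<forall>j. (real_perm r ^^ j) m = m \<longleftrightarrow> k + 2 dvd j"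
  then obtain m where m: "\<And>j. (real_perm r ^^ j) m = m \<longleftrightarrow> k + 2 dvd j" by blast
  obtain k' l where kl: "m = prod_encode (k', l)" by (metis prod_decode_inverse surj_pair)
  have *: "(below r k' \<and> l < k' + 2 \<longrightarrow> k' + 2 dvd j) \<longleftrightarrow> k + 2 dvd j" for j
    using m[of j] by (simp only: kl real_perm_funpow_fixed_iff)
  \<comment> \<open>The exponent 1 shows that \<open>m\<close> is not fixed, so it lies on the cycle
    of column \<open>k'\<close>. Comparing exponents \<open>k' + 2\<close> and \<open>k + 2\<close>
    then identifies the columns.\<close>
  have "\<not> k + 2 dvd 1" by simp
  with *[of 1] have b: "below r k'" "l < k' + 2" by blast+
  then have "k' + 2 dvd j \<longleftrightarrow> k + 2 dvd j" for j using *[of j] by blast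
  from this[of "k' + 2"] this[of "k + 2"] have "k' + 2 = k + 2"
    by (metis dvd_antisym dvd_refl)
  with b show "below r k" by simp
qed

lemma real_perm_funpow_cycle: "(real_perm r ^^ (fst (prod_decode m) + 2)) m = m"
proof -
  obtain k l where kl: "m = prod_encode (k, l)" by (metis prod_decode_inverse surj_pair)
  then show ?thesis by (simp only: kl prod_encode_inverse fst_conv real_perm_funpow_fixed_iff) simp
qed

text \<open>Columns are preserved and iterate \<open>k + 2\<close> is the identity on column
  \<open>k\<close>, so iterate \<open>k + 1\<close> inverts the map there.\<close>

lemma bij_real_perm: "bij (real_perm r)"
proof (rule bijI)
  have fst: "fst (prod_decode (real_perm r m)) = fst (prod_decode m)" for m
    by (simp add: real_perm_def split: prod.split)
  have cycle: "(real_perm r ^^ Suc (fst (prod_decode m))) (real_perm r m) = m" for m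
    using real_perm_funpow_cycle[of m r] by (simp add: funpow_swap1)
  show "inj (real_perm r)" by (rule injI) (metis cycle fst)
  show "surj (real_perm r)"
    by (rule surjI[of _ "\<lambda>m. (real_perm r ^^ Suc (fst (prod_decode m))) m"])
      (use cycle in \<open>simp add: funpow_swap1\<close>)
qed

text \<open>Every entry of the sequence is used on infinitely many fibres, so that only the range of the
  sequence matters.\<close>

definition entry :: "(nat \<Rightarrow> real) \<Rightarrow> nat \<Rightarrow> real" where
  "entry \<sigma> i = \<sigma> (fst (prod_decode i))"

definition seq_aut :: "(nat \<Rightarrow> real) \<Rightarrow> nat \<times> nat \<Rightarrow> nat \<times> nat" where
  "seq_aut \<sigma> x = (fst x, real_perm (entry \<sigma> (fst x)) (snd x))"

lemma range_entry: "range (entry \<sigma>) = range \<sigma>"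
  by (auto simp: entry_def image_iff) (metis fst_conv prod_encode_inverse)

lemma seq_aut_Aut: "seq_aut \<sigma> \<in> Aut"
proof -
  have "bij (seq_aut \<sigma>)"
  proof (rule bijI')
    show "seq_aut \<sigma> x = seq_aut \<sigma> y \<longleftrightarrow> x = y" for x y
      using bij_is_inj[OF bij_real_perm] by (auto simp: seq_aut_def prod_eq_iff inj_eq)
    show "\<exists>x. y = seq_aut \<sigma> x" for y
      using surj_f_inv_f[OF bij_is_surj[OF bij_real_perm]]
      by (intro exI[of _ "(fst y, inv (real_perm (entry \<sigma> (fst y))) (snd y))"])
        (simp add: seq_aut_def)
  qed
  then show ?thesis by (simp add: Aut_iff seq_aut_def)
qed

lemma seq_aut_funpow: "(seq_aut \<sigma> ^^ j) (i, m) = (i, (real_perm (entry \<sigma> i) ^^ j) m)"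
  by (induction j) (simp_all add: seq_aut_def)

text \<open>For equality each index is its own class, and each value of
  \<open>entry \<sigma>\<close> is taken infinitely often, so all ranks occur.\<close>

lemma ranked_labels_entry:
  "ranked_labels (=) (entry \<sigma>) = range \<sigma> \<times> UNIV"
proof -
  have "\<exists>F. finite F \<and> card F = Suc k \<and> (\<forall>i\<in>F. entry \<sigma> i = \<sigma> n)" for k n
  proof (intro exI conjI)
    show "card ((\<lambda>j. prod_encode (n, j)) ` {..k}) = Suc k"
      by (subst card_image) (simp_all add: inj_on_def)
  qed (auto simp: entry_def)
  moreover have "l \<in> range \<sigma>" if "card F = Suc k" "\<forall>i\<in>F. entry \<sigma> i = l" for F l k
  proof -
    from that(1) have "F \<noteq> {}" by auto
    then obtain i where "i \<in> F" by blast
    then show ?thesis using that(2) by (auto simp: entry_def)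
  qed
  ultimately have "(l, k) \<in> ranked_labels (=) (entry \<sigma>) \<longleftrightarrow> l \<in> range \<sigma>" for l k
    by (subst mem_ranked_labels_iff) (auto simp: identity_equivp)
  then show ?thesis by auto
qed

text \<open>Equal ranges give equal multiplicities, hence a permutation \<open>h\<close> of the
  copies that matches entries. Permuting whole copies by \<open>h\<close> conjugates.\<close>

lemma seq_aut_conjugate:
  assumes "range \<sigma> = range \<tau>"
  shows "(seq_aut \<sigma>, seq_aut \<tau>) \<in> conjugacy Aut"
proof -
  have "ranked_labels (=) (entry \<sigma>) = ranked_labels (=) (entry \<tau>)"
    by (simp add: ranked_labels_entry assms)
  moreover have "class_minima (=) = (UNIV :: nat set)" by (auto simp: class_minima_def)
  ultimately obtain h where h: "bij h" "\<forall>i. entry \<tau> (h i) = entry \<sigma> i"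
    using ranked_labels_eqE by (metis UNIV_I)
  define \<delta> where "\<delta> = map_prod h (id :: nat \<Rightarrow> nat)"
  have "bij \<delta>" unfolding \<delta>_def using h(1)
    by (simp add: bij_def prod.inj_map map_prod_surj)
  then have "\<delta> \<in> Aut"
    using bij_is_inj[OF h(1)] by (simp add: Aut_iff \<delta>_def inj_eq)
  moreover have "\<delta> \<circ> seq_aut \<sigma> = seq_aut \<tau> \<circ> \<delta>"
    by (simp add: fun_eq_iff \<delta>_def seq_aut_def h(2))
  ultimately show ?thesis by (auto simp: conjugacy_Aut_iff seq_aut_Aut)
qed

text \<open>The conjugating \<delta> carries copy \<open>i\<close> onto copy
  \<open>base \<delta> i\<close> and preserves periods of points, so both copies code the same
  real.\<close>

lemma range_subset_if_conjugate:
  assumes "(seq_aut \<sigma>, seq_aut \<tau>) \<in> conjugacy Aut"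
  shows "range \<sigma> \<subseteq> range \<tau>"
proof -
  obtain \<delta> where \<delta>: "\<delta> \<in> Aut" and comm: "\<delta> \<circ> seq_aut \<sigma> = seq_aut \<tau> \<circ> \<delta>"
    using assms by (auto simp: conjugacy_Aut_iff)
  have pow: "\<delta> ((seq_aut \<sigma> ^^ j) x) = (seq_aut \<tau> ^^ j) (\<delta> x)" for j x
    using fun_cong[OF comm] by (induction j) simp_all
  have "entry \<sigma> i = entry \<tau> (base \<delta> i)" for i
  proof (rule below_inj)
    fix k
    let ?P = "\<lambda>\<sigma> x. \<forall>j. (seq_aut \<sigma> ^^ j) x = x \<longleftrightarrow> k + 2 dvd j"
    have below: "below (entry \<rho> i) k \<longleftrightarrow> (\<exists>x. fst x = i \<and> ?P \<rho> x)" for \<rho> i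
      by (simp add: below_iff_cycle seq_aut_funpow)
    have P: "?P \<tau> (\<delta> x) \<longleftrightarrow> ?P \<sigma> x" for x
      by (simp add: inj_eq[OF Aut_inj[OF \<delta>]] flip: pow)
    have fst: "fst (\<delta> x) = base \<delta> i \<longleftrightarrow> fst x = i" for x
      using Aut_base_inj[OF \<delta>] by (simp add: Aut_fst[OF \<delta>] inj_eq)
    have ex: "(\<exists>y. Q y) \<longleftrightarrow> (\<exists>x. Q (\<delta> x))" for Q
      using bij_is_surj[OF Aut_bij[OF \<delta>]] by (metis surjD)
    have "(\<exists>x. fst x = base \<delta> i \<and> ?P \<tau> x) \<longleftrightarrow> (\<exists>x. fst (\<delta> x) = base \<delta> i \<and> ?P \<tau> (\<delta> x))"
      by (rule ex)
    then show "below (entry \<sigma> i) k \<longleftrightarrow> below (entry \<tau> (base \<delta> i)) k"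
      by (simp only: below P fst)
  qed
  then have "range (entry \<sigma>) \<subseteq> range (entry \<tau>)" by auto
  then show ?thesis by (simp add: range_entry)
qed

text \<open>The image of a fixed vertex depends only on whether one fixed rational is below one
  fixed term of the sequence.\<close>

lemma measurable_seq_aut: "seq_aut \<in> borel \<rightarrow>\<^sub>M aut_inf_K_inf"
  unfolding aut_inf_K_inf_def
proof (rule measurable_restrict_space2)
  show "seq_aut \<in> space borel \<rightarrow> Aut" by (simp add: seq_aut_Aut)
  show "seq_aut \<in> borel_measurable borel"
  proof (rule measurable_coordinatewise_then_product)
    fix x :: "nat \<times> nat"
    obtain i m where x: "x = (i, m)" by fastforce
    obtain k l where m: "prod_decode m = (k, l)" by fastforce
    have "(\<lambda>\<sigma> :: nat \<Rightarrow> real. seq_aut \<sigma> x) =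
        (\<lambda>\<sigma>. if real_of_rat (from_nat k) < \<sigma> (fst (prod_decode i)) \<and> l < k + 2
          then (i, prod_encode (k, Suc l mod (k + 2))) else (i, m))"
      by (simp add: fun_eq_iff x m seq_aut_def real_perm_def below_def entry_def)
    then show "(\<lambda>\<sigma> :: nat \<Rightarrow> real. seq_aut \<sigma> x) \<in> borel_measurable borel"
      by simp
  qed
qed

lemma E_set_reducible_conjugacy:
  "borel_reducible (borel :: (nat \<Rightarrow> real) measure) E_set aut_inf_K_inf (conjugacy Aut)"
  unfolding borel_reducible_def
proof (intro bexI[OF _ measurable_seq_aut] ballI)
  fix \<sigma> \<tau> :: "nat \<Rightarrow> real"
  \<comment> \<open>Symmetry of conjugacy supplies the reverse inclusion of ranges.\<close>
  have "(seq_aut \<tau>, seq_aut \<sigma>) \<in> conjugacy Aut" if "(seq_aut \<sigma>, seq_aut \<tau>) \<in> conjugacy Aut"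
    using that equiv_conjugacy[of inf_K_inf] by (meson equivE symD)
  then show "(\<sigma>, \<tau>) \<in> E_set \<longleftrightarrow> (seq_aut \<sigma>, seq_aut \<tau>) \<in> conjugacy Aut"
    using seq_aut_conjugate[of \<sigma> \<tau>] range_subset_if_conjugate[of \<sigma> \<tau>]
      range_subset_if_conjugate[of \<tau> \<sigma>] by (auto simp: E_set_def)
qed

theorem theorem3p2:
  shows "borel_bireducible
           aut_inf_K_inf (conjugacy (graph_automorphisms inf_K_inf))
           (borel :: (nat \<Rightarrow> real) measure) E_set"
  unfolding borel_bireducible_def
  by (rule conjI[OF conjugacy_reducible_E_set E_set_reducible_conjugacy])

end
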